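(* Let $a, b, d, n$ be positive integers such that $d \mid b$ and $\gcd(a,b)=1$. Let $$S := \left\langle a^n,\ a^n + a^{n-1}d,\ a^n + 2a^{n-1}d,\ \ldots,\ a^n + a^{n-1}b \right\rangle,$$ i.e. the semigroup generated by $a^n + j a^{n-1} d$ for $0 \le j \le b/d$. If $b \le a$, let $S_1 := \left\langle S \cup \{a^n + a^{n-2}b^2,\ a^n + a^{n-3}b^3, \ldots,\ a^n + ab^{n-1},\ a^n + b^n\}\right\rangle$. Without any condition relating $a$ and $b$, let $S_2 := \left\langle S \cup \{a^n + a^{n-1}b + a^{n-2}b^2,\ \ldots,\ a^n + a^{n-1}b + a^{n-2}b^2 + \cdots + b^n\}\right\rangle$ (the added generators being $a^n + \sum_{i=1}^{j} a^{n-i}b^i$ for $2 \le j \le n$). Then (when $b \le a$ in the first case) $$F(S_1) = a^{n-1}\left(a\left\lceil \tfrac{(a-1)d}{b} \right\rceil + ad - a - d\right) + (a-1)\frac{(n-1)a^n(a-b) + b^2\left(a^{n-1}-b^{n-1}\right)}{a-b},$$ $$F(S_2) = a^{n-1}\left(a\left\lceil \tfrac{(a-1)d}{b} \right\rceil + ad - a - d\right) + (a-1)\frac{(n-1)a^{n+1}(a-b) - b^3\left(a^{n-1}-b^{n-1}\right)}{(a-b)^2}.$$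
   Context: $\mathbb{N}$ denotes the nonnegative integers. For a set $A$ of positive integers, $\langle A\rangle$ is the additive submonoid of $\mathbb{N}$ generated by $A$ (all finite sums of elements of $A$, including $0$). A numerical semigroup is a submonoid $S\subseteq\mathbb{N}$ with $\mathbb{N}\setminus S$ finite; its Frobenius number $F(S)$ is the largest integer not in $S$ (with $F(\mathbb{N})=-1$). *)

theory Defs
  imports Complex_Main
begin

definition generated :: "nat set \<Rightarrow> nat set" where
  "generated A = {sum_list xs |xs. set xs \<subseteq> A}"

definition numerical_semigroup :: "nat set \<Rightarrow> bool" where
  "numerical_semigroup S \<longleftrightarrow>
     0 \<in> S \<and> (\<forall>x\<in>S. \<forall>y\<in>S. x + y \<in> S) \<and> finite (- S)"

text \<open>The largest \<^emph>\<open>integer\<close> outside \<open>S\<close>, so that the value is \<open>-1\<close> for \<open>S = UNIV\<close>.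
  It is meaningful only if \<open>S\<close> has finite complement.\<close>

definition frobenius_number :: "nat set \<Rightarrow> int" where
  "frobenius_number S = (GREATEST z. z \<notin> int ` S)"

end

theory Submission
  imports Defs "HOL-Number_Theory.Cong"
begin

text \<open>
  Write \<open>k = b div d\<close>. Both families have the form \<open>g i = a ^ (n - i) * h i\<close> with \<open>h 1 = a + b\<close> and
  \<open>h (i + 1) = b * h i + e * a ^ i\<close>, where \<open>e = a - b\<close> for \<open>S1\<close> and \<open>e = a\<close> for \<open>S2\<close>; hence
  \<open>a * g (i + 1) = b * g i + e * a ^ n\<close>. Exchanging \<open>a\<close> copies of \<open>g (i + 1)\<close> for \<open>b\<close> copies of \<open>g i\<close>
  and copies of \<open>a ^ n\<close> brings every element into the form
  \<open>(\<Sum>i=2..n. c i * g i) + m * a ^ n + j * a ^ (n - 1) * d\<close> with digits \<open>c i, j < a\<close> and \<open>j \<le> m * k\<close>.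
  Since \<open>d\<close> and all \<open>h i\<close> are coprime to \<open>a\<close>, the digits parametrise the residues modulo \<open>a ^ n\<close>
  bijectively, so taking \<open>m\<close> minimal gives the Apery set with respect to \<open>a ^ n\<close>. Its largest
  element has all digits equal to \<open>a - 1\<close>, and subtracting \<open>a ^ n\<close> gives the Frobenius number.
\<close>

section \<open>Generated submonoids\<close>

lemma generated_zero: "0 \<in> generated A"
  unfolding generated_def by (auto intro!: exI[of _ "[]"])

lemma generated_base: "x \<in> A \<Longrightarrow> x \<in> generated A"
  unfolding generated_def by (auto intro!: exI[of _ "[x]"])

lemma generated_add:
  assumes "x \<in> generated A" "y \<in> generated A"
  shows "x + y \<in> generated A"
proof -
  obtain xs ys where "x = sum_list xs" "set xs \<subseteq> A" "y = sum_list ys" "set ys \<subseteq> A"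
    using assms unfolding generated_def by blast
  then have "x + y = sum_list (xs @ ys)" "set (xs @ ys) \<subseteq> A"
    by auto
  then show ?thesis
    unfolding generated_def by blast
qed

lemma generated_mult: "x \<in> generated A \<Longrightarrow> m * x \<in> generated A"
  by (induction m) (auto intro: generated_zero generated_add)

lemma generated_sum:
  "(\<And>i. i \<in> I \<Longrightarrow> f i \<in> generated A) \<Longrightarrow> sum f I \<in> generated A"
  by (induction I rule: infinite_finite_induct) (auto intro: generated_zero generated_add)

lemma generated_least:
  assumes "A \<subseteq> R" "0 \<in> R" "\<And>x y. x \<in> R \<Longrightarrow> y \<in> R \<Longrightarrow> x + y \<in> R"
  shows "generated A \<subseteq> R"
proof -
  have "set xs \<subseteq> A \<Longrightarrow> sum_list xs \<in> R" for xs
    using assms by (induction xs) auto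
  then show ?thesis
    unfolding generated_def by blast
qed

section \<open>Mixed digit expansions modulo a power\<close>

text \<open>Horner step: passing from \<open>n\<close> to \<open>Suc n\<close> multiplies every
  earlier term by \<open>a\<close>, so only the newest one is visible modulo \<open>a\<close>. It
  serves the digit inductions with \<open>l = 1\<close> and the closed forms with
  \<open>l = 2\<close>.\<close>

lemma sum_digits_Suc:
  fixes a :: "'a::comm_semiring_1"
  assumes "l \<le> Suc n"
  shows "(\<Sum>i=l..Suc n. c i * (a ^ (Suc n - i) * u i))
    = a * (\<Sum>i=l..n. c i * (a ^ (n - i) * u i)) + c (Suc n) * u (Suc n)"
proof -
  have "(\<Sum>i=l..n. c i * (a ^ (Suc n - i) * u i)) = a * (\<Sum>i=l..n. c i * (a ^ (n - i) * u i))"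
    unfolding sum_distrib_left by (rule sum.cong) (auto simp: Suc_diff_le algebra_simps)
  then show ?thesis
    using assms by simp
qed

text \<open>Modulo \<open>a\<close> only the last digit survives; its unit cancels by coprimality
  and the range condition fixes it. Removing that term and dividing by \<open>a\<close> leaves the
  congruence modulo the next lower power.\<close>

lemma digits_unique:
  fixes a :: int and c c' u :: "nat \<Rightarrow> int"
  assumes "\<And>i. 1 \<le> i \<Longrightarrow> i \<le> n \<Longrightarrow> coprime a (u i)" and "a > 0"
    and "\<And>i. 1 \<le> i \<Longrightarrow> i \<le> n \<Longrightarrow> 0 \<le> c i \<and> c i < a"
    and "\<And>i. 1 \<le> i \<Longrightarrow> i \<le> n \<Longrightarrow> 0 \<le> c' i \<and> c' i < a"
    and "[(\<Sum>i=1..n. c i * (a ^ (n - i) * u i)) = (\<Sum>i=1..n. c' i * (a ^ (n - i) * u i))] (mod a ^ n)"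
    and "1 \<le> i" "i \<le> n"
  shows "c i = c' i"
  using assms
proof (induction n arbitrary: i)
  case 0
  then show ?case by simp
next
  case (Suc n)
  define X where "X = (\<Sum>i=1..n. c i * (a ^ (n - i) * u i))"
  define Y where "Y = (\<Sum>i=1..n. c' i * (a ^ (n - i) * u i))"
  have eq: "[a * X + c (Suc n) * u (Suc n) = a * Y + c' (Suc n) * u (Suc n)] (mod a * a ^ n)"
    using Suc.prems(5) sum_digits_Suc[of 1 n c a u] sum_digits_Suc[of 1 n c' a u]
    unfolding X_def Y_def by simp
  then have "[a * X + c (Suc n) * u (Suc n) = a * Y + c' (Suc n) * u (Suc n)] (mod a)"
    by (rule cong_modulus_mult)
  then have "[c (Suc n) * u (Suc n) = c' (Suc n) * u (Suc n)] (mod a)"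
    by (simp add: cong_def)
  moreover have "coprime (u (Suc n)) a"
    using Suc.prems(1)[of "Suc n"] by (simp add: coprime_commute)
  ultimately have "[c (Suc n) = c' (Suc n)] (mod a)"
    by (simp add: cong_mult_rcancel)
  then have top: "c (Suc n) = c' (Suc n)"
    using Suc.prems(3,4)[of "Suc n"] by (simp add: cong_def)
  have "a * a ^ n dvd a * (X - Y)"
    using eq top by (simp add: cong_iff_dvd_diff algebra_simps)
  then have "[X = Y] (mod a ^ n)"
    using \<open>a > 0\<close> by (simp add: cong_iff_dvd_diff)
  then have "c i = c' i" if "1 \<le> i" "i \<le> n" for i
    using Suc.IH[of i] Suc.prems(1-4) that unfolding X_def Y_def by simp
  then show ?case
    using top Suc.prems(6,7) by (cases "i = Suc n") auto
qed

text \<open>The last digit is \<open>x\<close> times the inverse of its unit, reduced modulo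
  \<open>a\<close>; what remains is divisible by \<open>a\<close>, and the quotient is expanded
  recursively.\<close>

lemma digits_exist:
  fixes a :: int and u :: "nat \<Rightarrow> int"
  assumes "\<And>i. 1 \<le> i \<Longrightarrow> i \<le> n \<Longrightarrow> coprime a (u i)" and "a > 0"
  obtains c where "\<And>i. 0 \<le> c i \<and> c i < a"
    and "[x = (\<Sum>i=1..n. c i * (a ^ (n - i) * u i))] (mod a ^ n)"
proof -
  have "\<exists>c. (\<forall>i. 0 \<le> c i \<and> c i < a) \<and>
      [x = (\<Sum>i=1..n. c i * (a ^ (n - i) * u i))] (mod a ^ n)"
    using assms(1)
  proof (induction n arbitrary: x)
    case 0
    then show ?case
      using \<open>a > 0\<close> by (auto intro!: exI[of _ "\<lambda>_. 0"])
  next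
    case (Suc n)
    have "coprime (u (Suc n)) a"
      using Suc.prems[of "Suc n"] by (simp add: coprime_commute)
    then obtain v where v: "[u (Suc n) * v = 1] (mod a)"
      using cong_solve_coprime_int by blast
    define r where "r = (x * v) mod a"
    have "[r * u (Suc n) = x * v * u (Suc n)] (mod a)"
      unfolding r_def by (intro cong_mult cong_refl) (simp add: cong_def)
    also have "[x * v * u (Suc n) = x * 1] (mod a)"
      using cong_mult[OF cong_refl[of x] v] by (simp add: algebra_simps)
    finally have "a dvd x - r * u (Suc n)"
      by (simp add: cong_iff_dvd_diff dvd_diff_commute)
    then obtain y where y: "x - r * u (Suc n) = a * y"
      by blast
    obtain c where c: "\<forall>i. 0 \<le> c i \<and> c i < a"
      and cy: "[y = (\<Sum>i=1..n. c i * (a ^ (n - i) * u i))] (mod a ^ n)"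
      using Suc.IH[of y] Suc.prems by auto
    define c' where "c' = c(Suc n := r)"
    have "[a * y = a * (\<Sum>i=1..n. c i * (a ^ (n - i) * u i))] (mod a * a ^ n)"
      using cy by (simp add: cong_iff_dvd_diff flip: right_diff_distrib)
    then have "[a * y + r * u (Suc n)
        = a * (\<Sum>i=1..n. c i * (a ^ (n - i) * u i)) + r * u (Suc n)] (mod a * a ^ n)"
      by (intro cong_add cong_refl)
    moreover have "(\<Sum>i=1..n. c' i * (a ^ (n - i) * u i)) = (\<Sum>i=1..n. c i * (a ^ (n - i) * u i))"
      unfolding c'_def by (rule sum.cong) auto
    moreover have "c' (Suc n) = r"
      by (simp add: c'_def)
    moreover have "x = a * y + r * u (Suc n)"
      using y by simp
    ultimately have "[x = (\<Sum>i=1..Suc n. c' i * (a ^ (Suc n - i) * u i))] (mod a ^ Suc n)"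
      using sum_digits_Suc[of 1 n c' a u] by simp
    moreover have "\<forall>i. 0 \<le> c' i \<and> c' i < a"
      using c \<open>a > 0\<close> by (auto simp: c'_def r_def)
    ultimately show ?case
      by blast
  qed
  then show ?thesis
    using that by blast
qed

section \<open>The Frobenius number of a chain of generators\<close>

text \<open>Having \<open>e\<close> in the naturals is what keeps the exchange of generators inside
  the semigroup; for the first family this is where \<open>b \<le> a\<close> enters.\<close>

locale generator_chain =
  fixes a b d k n e :: nat and h :: "nat \<Rightarrow> nat"
  assumes a_pos: "a > 0" and d_pos: "d > 0" and k_pos: "k > 0" and n_pos: "n > 0"
    and b_eq: "b = k * d" and coprime_ab: "coprime a b"
    and h_1: "h 1 = a + b"
    and h_Suc: "1 \<le> i \<Longrightarrow> h (Suc i) = b * h i + e * a ^ i"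
begin

definition g :: "nat \<Rightarrow> nat" where
  "g i = a ^ (n - i) * h i"

text \<open>The bound \<open>t\<close> allows induction along the chain. The membership condition
  \<open>j \<le> m * k\<close> stays outside, so that residues can be studied for arbitrary
  \<open>m\<close>.\<close>

definition expansion :: "nat \<Rightarrow> (nat \<Rightarrow> nat) \<Rightarrow> nat \<Rightarrow> nat \<Rightarrow> nat" where
  "expansion t c j m = (\<Sum>i=2..t. c i * g i) + m * a ^ n + j * a ^ (n - 1) * d"

definition semigroup :: "nat set" where
  "semigroup = generated (generated {a ^ n + j * a ^ (n - 1) * d |j. j \<le> k} \<union> {g i |i. 2 \<le> i \<and> i \<le> n})"

text \<open>Modulo \<open>a\<close> the recursion reads \<open>h (Suc i) = b * h i\<close>, starting
  from \<open>h 1 = b\<close>.\<close>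

lemma coprime_h: "1 \<le> i \<Longrightarrow> coprime a (h i)"
proof (induction i rule: dec_induct)
  case base
  then show ?case
    using coprime_ab h_1 by (simp add: coprime_iff_gcd_eq_1)
next
  case (step i)
  have "coprime a (b * h i)"
    using step coprime_ab by simp
  moreover have "a ^ i = a ^ (i - 1) * a"
    using step by (cases i) auto
  then have "h (Suc i) = (e * a ^ (i - 1)) * a + b * h i"
    using h_Suc[of i] step by simp
  ultimately show ?case
    by (simp only: coprime_iff_gcd_eq_1 gcd_add_mult)
qed

lemma a_g_Suc:
  assumes "1 \<le> i" "Suc i \<le> n"
  shows "a * g (Suc i) = b * g i + e * a ^ n"
proof -
  have "n - i = Suc (n - Suc i)"
    using assms by simp
  moreover have "a ^ n = a ^ i * a ^ (n - i)"
    using assms by (simp flip: power_add)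
  ultimately show ?thesis
    unfolding g_def using h_Suc[OF assms(1)] by (simp add: algebra_simps)
qed

text \<open>The chain starts at the largest arithmetic generator, so carries that reach position 1
  are absorbed by the arithmetic part.\<close>

lemma g_1: "g 1 = a ^ n + k * a ^ (n - 1) * d"
  unfolding g_def h_1 b_eq using n_pos by (cases n) (auto simp: algebra_simps)

section \<open>Semigroup elements as expansions\<close>

lemma expansion_add:
  "expansion t c j m + expansion t c' j' m' = expansion t (\<lambda>i. c i + c' i) (j + j') (m + m')"
  by (simp add: expansion_def sum.distrib algebra_simps)

text \<open>Each of the \<open>m\<close> summands can carry up to \<open>k\<close> steps of size
  \<open>a ^ (n - 1) * d\<close>; they are filled greedily.\<close>

lemma arithmetic_part_in_semigroup: "j \<le> m * k \<Longrightarrow> m * a ^ n + j * a ^ (n - 1) * d \<in> semigroup"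
proof (induction m arbitrary: j)
  case 0
  then show ?case
    by (simp add: semigroup_def generated_zero)
next
  case (Suc m)
  define l l' where "l = min j k" and "l' = j - l"
  have "a ^ n + l * a ^ (n - 1) * d \<in> semigroup"
    unfolding semigroup_def by (intro generated_base UnI1) (auto simp: l_def)
  moreover have "m * a ^ n + l' * a ^ (n - 1) * d \<in> semigroup"
    using Suc.prems by (intro Suc.IH) (auto simp: l_def l'_def)
  ultimately have "(a ^ n + l * a ^ (n - 1) * d) + (m * a ^ n + l' * a ^ (n - 1) * d) \<in> semigroup"
    unfolding semigroup_def by (rule generated_add)
  moreover have "j = l + l'"
    by (simp add: l_def l'_def)
  ultimately show ?case
    by (simp add: algebra_simps)
qed

lemma expansion_in_semigroup:
  assumes "j \<le> m * k"
  shows "expansion n c j m \<in> semigroup"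
proof -
  have "g i \<in> semigroup" if "i \<in> {2..n}" for i
    using that unfolding semigroup_def by (intro generated_base UnI2) auto
  then have "(\<Sum>i=2..n. c i * g i) \<in> semigroup"
    unfolding semigroup_def by (blast intro: generated_sum generated_mult)
  then show ?thesis
    using arithmetic_part_in_semigroup[OF assms] generated_add
    unfolding expansion_def semigroup_def add.assoc by blast
qed

text \<open>The expansions with \<open>j \<le> m * k\<close> contain all generators and are closed
  under addition, because both sides of the condition are additive.\<close>

lemma semigroup_expansion:
  assumes "x \<in> semigroup"
  obtains c j m where "x = expansion n c j m" "j \<le> m * k"
proof -
  define R where "R = {expansion n c j m |c j m. j \<le> m * k}"
  have zero: "0 \<in> R"
    unfolding R_def expansion_def by (auto intro!: exI[of _ "\<lambda>_. 0"] exI[of _ 0])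
  have add: "x + y \<in> R" if x: "x \<in> R" and y: "y \<in> R" for x y
  proof -
    obtain c j m where "x = expansion n c j m" "j \<le> m * k"
      using x unfolding R_def by blast
    moreover obtain c' j' m' where "y = expansion n c' j' m'" "j' \<le> m' * k"
      using y unfolding R_def by blast
    ultimately have "x + y = expansion n (\<lambda>i. c i + c' i) (j + j') (m + m')" "j + j' \<le> (m + m') * k"
      by (auto simp: expansion_add algebra_simps)
    then show ?thesis
      unfolding R_def by blast
  qed
  have "a ^ n + j * a ^ (n - 1) * d \<in> R" if "j \<le> k" for j
  proof -
    have "a ^ n + j * a ^ (n - 1) * d = expansion n (\<lambda>_. 0) j 1"
      by (simp add: expansion_def)
    then show ?thesis
      unfolding R_def using that by fastforce
  qed
  then have "generated {a ^ n + j * a ^ (n - 1) * d |j. j \<le> k} \<subseteq> R"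
    by (intro generated_least zero add) auto
  moreover have "g i \<in> R" if "2 \<le> i" "i \<le> n" for i
  proof -
    have "g i = expansion n (\<lambda>l. if l = i then 1 else 0) 0 0"
      using that by (simp add: expansion_def if_distrib[of "\<lambda>x. x * _"] cong: if_cong)
    then show ?thesis
      unfolding R_def by blast
  qed
  ultimately have "semigroup \<subseteq> R"
    unfolding semigroup_def by (intro generated_least zero add) auto
  then show ?thesis
    using assms that unfolding R_def by blast
qed

section \<open>Reduction to digits below \<open>a\<close>\<close>

text \<open>Carries run downwards from position \<open>t\<close>: reducing the top coefficient
  modulo \<open>a\<close> enlarges only the one below it and \<open>m\<close>, and the induction
  hypothesis, stated for arbitrary coefficients, handles the rest.\<close>

lemma expansion_normalise:
  assumes "1 \<le> t" "t \<le> n" "j \<le> m * k"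
  shows "\<exists>c' j' m'. expansion t c j m = expansion t c' j' m' \<and>
    (\<forall>i\<in>{2..t}. c' i < a) \<and> j' < a \<and> j' \<le> m' * k"
  using assms
proof (induction t arbitrary: c j m rule: dec_induct)
  case base
  \<comment> \<open>Here \<open>a\<close> steps of size \<open>a ^ (n - 1) * d\<close> amount to
    \<open>d\<close> copies of \<open>a ^ n\<close>. Reducing \<open>j\<close> modulo
    \<open>a\<close> thus lowers \<open>j\<close> and never lowers \<open>m\<close>.\<close>
  have "a ^ n = a * a ^ (n - 1)"
    using n_pos by (simp add: power_eq_if)
  moreover obtain q r where j: "j = a * q + r" "r < a"
    using a_pos by (metis mult_div_mod_eq mod_less_divisor)
  ultimately have "expansion 1 c j m = expansion 1 c r (m + q * d)"
    by (simp add: expansion_def algebra_simps)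
  moreover have "r \<le> (m + q * d) * k"
    using base j(1) by (simp add: add_mult_distrib)
  ultimately show ?case
    using j(2) by (intro exI[of _ c] exI[of _ r] exI[of _ "m + q * d"]) auto
next
  case (step t)
  define q where "q = c (Suc t) div a"
  define r where "r = c (Suc t) mod a"
  have "c (Suc t) = q * a + r"
    by (simp add: q_def r_def)
  then have "c (Suc t) * g (Suc t) = q * (a * g (Suc t)) + r * g (Suc t)"
    by (simp add: algebra_simps)
  then have carry: "c (Suc t) * g (Suc t) = q * b * g t + q * e * a ^ n + r * g (Suc t)"
    using a_g_Suc[of t] step by (simp add: algebra_simps)
  have split: "expansion (Suc t) c j m = expansion t c j m + c (Suc t) * g (Suc t)" for c j m
    using step by (simp add: expansion_def)
  \<comment> \<open>At \<open>t = 1\<close> there is no coefficient to receive the carry: each copy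
    of \<open>g 1\<close> adds 1 to \<open>m\<close> and \<open>k\<close> to \<open>j\<close>, which
    preserves the bound.\<close>
  obtain c1 j1 m1 where 1: "expansion t c j m + q * b * g t = expansion t c1 j1 m1" "j1 \<le> m1 * k"
  proof (cases "t = 1")
    case True
    have "expansion t c j m + q * b * g t = expansion t c (j + q * b * k) (m + q * b)"
      using g_1 True by (simp add: expansion_def algebra_simps)
    moreover have "j + q * b * k \<le> (m + q * b) * k"
      using step by (simp add: algebra_simps)
    ultimately show ?thesis
      using that by blast
  next
    case False
    have "{2..t} = insert t {2..<t}"
      using step False by auto
    moreover have "(\<Sum>i=2..<t. (c(t := c t + q * b)) i * g i) = (\<Sum>i=2..<t. c i * g i)"
      by (rule sum.cong) auto
    ultimately have "expansion t c j m + q * b * g t = expansion t (c(t := c t + q * b)) j m"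
      by (simp add: expansion_def algebra_simps)
    then show ?thesis
      using that step by blast
  qed
  have "expansion (Suc t) c j m = expansion t c1 j1 (m1 + q * e) + r * g (Suc t)"
    using split[of c j m] carry 1(1) by (simp add: expansion_def algebra_simps)
  moreover have "j1 \<le> (m1 + q * e) * k"
    using 1(2) by (simp add: add_mult_distrib)
  then have "\<exists>c2 j2 m2. expansion t c1 j1 (m1 + q * e) = expansion t c2 j2 m2 \<and>
      (\<forall>i\<in>{2..t}. c2 i < a) \<and> j2 < a \<and> j2 \<le> m2 * k"
    using step by simp
  then obtain c2 j2 m2 where 2: "expansion t c1 j1 (m1 + q * e) = expansion t c2 j2 m2"
    "\<forall>i\<in>{2..t}. c2 i < a" "j2 < a" "j2 \<le> m2 * k"
    by blast
  moreover have "expansion t (c2(Suc t := r)) j2 m2 = expansion t c2 j2 m2"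
    unfolding expansion_def by (auto intro!: sum.cong)
  ultimately have "expansion (Suc t) c j m = expansion (Suc t) (c2(Suc t := r)) j2 m2"
    using split[of "c2(Suc t := r)" j2 m2] by simp
  moreover have "\<forall>i\<in>{2..Suc t}. (c2(Suc t := r)) i < a"
    using 2(2) a_pos by (auto simp: r_def)
  ultimately show ?case
    using 2(3,4) by blast
qed

section \<open>Digits and residues modulo \<open>a ^ n\<close>\<close>

text \<open>The digit \<open>j\<close> is stored at position 1, whose unit is \<open>d\<close>.\<close>

definition digit_unit :: "nat \<Rightarrow> nat" where
  "digit_unit i = (if i = 1 then d else h i)"

lemma coprime_digit_unit: "1 \<le> i \<Longrightarrow> coprime (int a) (int (digit_unit i))"
  using coprime_h[of i] coprime_ab b_eq by (auto simp: digit_unit_def)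

lemma int_expansion:
  "int (expansion n c j m)
    = (\<Sum>i=1..n. int ((c(1 := j)) i) * (int a ^ (n - i) * int (digit_unit i))) + int m * int a ^ n"
proof -
  have "{1..n} = insert 1 {2..n}"
    using n_pos by auto
  moreover have "(\<Sum>i=2..n. int ((c(1 := j)) i) * (int a ^ (n - i) * int (digit_unit i)))
      = (\<Sum>i=2..n. int (c i * g i))"
    by (rule sum.cong) (auto simp: g_def digit_unit_def)
  ultimately show ?thesis
    by (simp add: expansion_def digit_unit_def)
qed

lemma expansion_unique:
  assumes "[int (expansion n c j m) = int (expansion n c' j' m')] (mod int a ^ n)"
    and "\<forall>i\<in>{2..n}. c i < a" "j < a" "\<forall>i\<in>{2..n}. c' i < a" "j' < a"
  shows "j = j'" and "\<forall>i\<in>{2..n}. c i = c' i"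
proof -
  have "int ((c(1 := j)) i) = int ((c'(1 := j')) i)" if "1 \<le> i" "i \<le> n" for i
  proof (rule digits_unique[where n = n and a = "int a" and c = "\<lambda>i. int ((c(1 := j)) i)"
      and c' = "\<lambda>i. int ((c'(1 := j')) i)" and u = "\<lambda>i. int (digit_unit i)"])
    show "[(\<Sum>i=1..n. int ((c(1 := j)) i) * (int a ^ (n - i) * int (digit_unit i)))
      = (\<Sum>i=1..n. int ((c'(1 := j')) i) * (int a ^ (n - i) * int (digit_unit i)))] (mod int a ^ n)"
      using assms(1) unfolding int_expansion by (simp add: cong_def)
  qed (use assms that a_pos coprime_digit_unit in auto)
  note eq = this
  show "j = j'"
    using eq[of 1] n_pos by simp
  show "\<forall>i\<in>{2..n}. c i = c' i"
  proof
    fix i assume "i \<in> {2..n}"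
    then show "c i = c' i"
      using eq[of i] by auto
  qed
qed

text \<open>The term with \<open>m\<close> vanishes modulo \<open>a ^ n\<close>, so the same digits
  serve every \<open>m\<close>, which can be chosen afterwards.\<close>

lemma expansion_exists:
  obtains c j where "\<And>i. c i < a" "j < a" "\<And>m. [z = int (expansion n c j m)] (mod int a ^ n)"
proof -
  obtain c where c: "\<And>i. 0 \<le> c i \<and> c i < int a"
    and z: "[z = (\<Sum>i=1..n. c i * (int a ^ (n - i) * int (digit_unit i)))] (mod int a ^ n)"
    using digits_exist[of n "int a" "\<lambda>i. int (digit_unit i)" z] a_pos coprime_digit_unit by auto
  have "int (((nat \<circ> c)(1 := nat (c 1))) i) = c i" for i
    using c[of i] c[of 1] by simp
  then have "[z = int (expansion n (nat \<circ> c) (nat (c 1)) m)] (mod int a ^ n)" for m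
    using z unfolding int_expansion by (simp add: cong_def)
  moreover have "nat (c i) < a" for i
    using c[of i] by (simp add: nat_less_iff)
  ultimately show ?thesis
    using that[of "nat \<circ> c" "nat (c 1)"] by simp
qed

section \<open>The largest gap\<close>

text \<open>The assumption characterises \<open>C\<close> as the least \<open>m\<close> that admits
  the digit \<open>j = a - 1\<close>, hence every smaller digit too.\<close>

lemma frobenius:
  assumes C: "\<And>m. a - 1 \<le> m * k \<longleftrightarrow> C \<le> m"
  shows "numerical_semigroup semigroup"
    and "frobenius_number semigroup = int (expansion n (\<lambda>_. a - 1) (a - 1) C) - int a ^ n"
proof -
  define M where "M = expansion n (\<lambda>_. a - 1) (a - 1) C"
  define F where "F = int M - int a ^ n"
  have large: "z \<in> int ` semigroup" if "z > F" for z
  proof -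
    obtain c j where c: "\<And>i. c i < a" "j < a" "[z = int (expansion n c j C)] (mod int a ^ n)"
      using expansion_exists[of z] by metis
    obtain q where q: "z - int (expansion n c j C) = int a ^ n * q"
      using c(3) unfolding cong_iff_dvd_diff by blast
    have "expansion n c j C \<le> M"
      unfolding M_def expansion_def
      using c(1,2) by (intro add_mono sum_mono mult_right_mono) (auto simp: Suc_leI le_diff_conv2)
    \<comment> \<open>The number \<open>z\<close> exceeds \<open>M - a ^ n\<close> while the
      expansion is at most \<open>M\<close>. Hence \<open>q\<close> is nonnegative and can be added
      to \<open>C\<close>.\<close>
    then have "int a ^ n * q > int a ^ n * (- 1)"
      using that q by (simp add: F_def)
    then have "- 1 < q"
      by (rule mult_left_less_imp_less) simp
    then have "z = int (expansion n c j (C + nat q))"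
      using q by (simp add: expansion_def algebra_simps)
    moreover have "a - 1 \<le> (C + nat q) * k"
      using C[of "C + nat q"] by simp
    then have "j \<le> (C + nat q) * k"
      using c(2) by linarith
    ultimately show ?thesis
      using expansion_in_semigroup by blast
  qed
  have gap: "F \<notin> int ` semigroup"
  proof
    assume "F \<in> int ` semigroup"
    then obtain x where x: "x \<in> semigroup" "F = int x"
      by blast
    obtain c j m where "x = expansion n c j m" "j \<le> m * k"
      using semigroup_expansion[OF x(1)] .
    then obtain c' j' m' where x': "x = expansion n c' j' m'"
      and *: "\<forall>i\<in>{2..n}. c' i < a" "j' < a" "j' \<le> m' * k"
      using expansion_normalise[of n j m c] n_pos by auto
    \<comment> \<open>By congruence, the normal form of \<open>F\<close> has the digits of
      \<open>M\<close>. Then \<open>m' = C - 1\<close>, too small for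
      \<open>j' = a - 1\<close>.\<close>
    have "int x - int M = - (int a ^ n)"
      using x(2) by (simp add: F_def)
    then have "[int x = int M] (mod int a ^ n)"
      by (simp add: cong_iff_dvd_diff)
    then have dig: "j' = a - 1" "\<forall>i\<in>{2..n}. c' i = a - 1"
      using expansion_unique[of c' j' m' "\<lambda>_. a - 1" "a - 1" C] * a_pos x' M_def by auto
    then have "(\<Sum>i=2..n. c' i * g i) = (\<Sum>i=2..n. (a - 1) * g i)"
      by (intro sum.cong) auto
    moreover have "M = x + a ^ n"
      using x(2) by (simp add: F_def) (metis add_diff_cancel_right' add_diff_eq diff_add_cancel
          of_nat_add of_nat_eq_iff of_nat_power)
    ultimately have "C * a ^ n = (m' + 1) * a ^ n"
      using x' dig(1) unfolding M_def expansion_def by simp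
    then have "C = m' + 1"
      using a_pos by (simp only: mult_cancel2 power_eq_0_iff) simp
    then show False
      using C[of m'] *(3) dig(1) by simp
  qed
  show "frobenius_number semigroup = int (expansion n (\<lambda>_. a - 1) (a - 1) C) - int a ^ n"
    unfolding frobenius_number_def
    by (rule Greatest_equality) (use gap large in \<open>force simp: F_def M_def\<close>)+
  have "x \<le> nat F" if "x \<notin> semigroup" for x
    using large[of "int x"] that by (force simp: image_iff)
  then have "- semigroup \<subseteq> {..nat F}"
    by auto
  then show "numerical_semigroup semigroup"
    unfolding numerical_semigroup_def semigroup_def
    by (auto intro: generated_zero generated_add finite_subset)
qed

lemma frobenius_real:
  assumes "semigroup = T"
  shows "numerical_semigroup T"
    and "real_of_int (frobenius_number T) =
      real a ^ (n - 1) * (real a * of_int \<lceil>(real a - 1) * real d / real b\<rceil>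
        + real a * real d - real a - real d)
      + (real a - 1) * (\<Sum>i=2..n. real (g i))"
proof -
  \<comment> \<open>Since \<open>b = k * d\<close>, this is the ceiling of
    \<open>(a - 1) / k\<close>; it is nonnegative, so \<open>nat\<close> loses nothing.\<close>
  define C where "C = nat \<lceil>(real a - 1) * real d / real b\<rceil>"
  have quot: "(real a - 1) * real d / real b = real (a - 1) / real k"
    using a_pos d_pos by (simp add: b_eq of_nat_diff)
  have "C \<le> m \<longleftrightarrow> real (a - 1) / real k \<le> real m" for m
    unfolding C_def quot by (simp add: nat_le_iff ceiling_le_iff)
  also have "real (a - 1) / real k \<le> real m \<longleftrightarrow> real (a - 1) \<le> real (m * k)" for m
    using k_pos by (simp add: divide_le_eq)
  finally have C: "a - 1 \<le> m * k \<longleftrightarrow> C \<le> m" for m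
    by (metis of_nat_le_iff)
  note frob = frobenius[OF C, unfolded assms]
  show "numerical_semigroup T"
    by (fact frob)
  have "0 \<le> (real a - 1) * real d / real b"
    unfolding quot by simp
  then have "real C = of_int \<lceil>(real a - 1) * real d / real b\<rceil>"
    by (simp add: C_def)
  moreover have "real (a - 1) = real a - 1"
    using a_pos by (simp add: of_nat_diff)
  moreover have "real a ^ n = real a * real a ^ (n - 1)"
    using n_pos by (simp add: power_eq_if)
  ultimately show "real_of_int (frobenius_number T) =
      real a ^ (n - 1) * (real a * of_int \<lceil>(real a - 1) * real d / real b\<rceil>
        + real a * real d - real a - real d)
      + (real a - 1) * (\<Sum>i=2..n. real (g i))"
    unfolding frob expansion_def
    by (simp flip: sum_distrib_left) (simp add: algebra_simps)
qed

end

section \<open>Closed forms\<close>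

text \<open>Multiplying by \<open>x - y\<close> avoids division; the induction on
  \<open>n - 1\<close> uses the Horner step.\<close>

lemma sum_first_family:
  fixes x y :: real
  assumes "n > 0"
  shows "(x - y) * (\<Sum>i=2..n. x ^ (n - i) * (x ^ i + y ^ i))
    = (real n - 1) * x ^ n * (x - y) + y ^ 2 * (x ^ (n - 1) - y ^ (n - 1))"
proof -
  have "(x - y) * (\<Sum>i=2..Suc m. x ^ (Suc m - i) * (x ^ i + y ^ i))
    = real m * x ^ Suc m * (x - y) + y ^ 2 * (x ^ m - y ^ m)" for m
  proof (induction m)
    case (Suc m)
    have "(\<Sum>i=2..Suc (Suc m). x ^ (Suc (Suc m) - i) * (x ^ i + y ^ i))
      = x * (\<Sum>i=2..Suc m. x ^ (Suc m - i) * (x ^ i + y ^ i)) + (x ^ (m + 2) + y ^ (m + 2))"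
      using sum_digits_Suc[of 2 "Suc m" "\<lambda>_. 1" x "\<lambda>i. x ^ i + y ^ i"] by simp
    then have "(x - y) * (\<Sum>i=2..Suc (Suc m). x ^ (Suc (Suc m) - i) * (x ^ i + y ^ i))
      = x * ((x - y) * (\<Sum>i=2..Suc m. x ^ (Suc m - i) * (x ^ i + y ^ i)))
        + (x - y) * (x ^ (m + 2) + y ^ (m + 2))"
      by (simp only: ring_distribs ac_simps)
    then show ?case
      unfolding Suc by (simp add: algebra_simps power2_eq_square)
  qed simp
  from this[of "n - 1"] show ?thesis
    using assms by (simp add: of_nat_diff)
qed

text \<open>One factor \<open>x - y\<close> collapses the inner geometric sum, the other the sum
  over \<open>i\<close>.\<close>

lemma sum_second_family:
  fixes x y :: real
  assumes "n > 0"
  shows "(x - y) ^ 2 * (\<Sum>i=2..n. x ^ (n - i) * (\<Sum>l\<le>i. x ^ (i - l) * y ^ l))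
    = (real n - 1) * x ^ (n + 1) * (x - y) - y ^ 3 * (x ^ (n - 1) - y ^ (n - 1))"
proof -
  have geo: "(x - y) * (\<Sum>l\<le>i. x ^ (i - l) * y ^ l) = x ^ Suc i - y ^ Suc i" for i
  proof -
    have "y ^ Suc i - x ^ Suc i = (y - x) * (\<Sum>l\<le>i. x ^ (i - l) * y ^ l)"
      using power_diff_sumr2[of y "Suc i" x] by (simp only: lessThan_Suc_atMost diff_Suc_Suc)
    then show ?thesis
      by (simp only: left_diff_distrib)
  qed
  have "(x - y) ^ 2 * (\<Sum>i=2..Suc m. x ^ (Suc m - i) * (\<Sum>l\<le>i. x ^ (i - l) * y ^ l))
    = real m * x ^ (m + 2) * (x - y) - y ^ 3 * (x ^ m - y ^ m)" for m
  proof (induction m)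
    case (Suc m)
    have "(\<Sum>i=2..Suc (Suc m). x ^ (Suc (Suc m) - i) * (\<Sum>l\<le>i. x ^ (i - l) * y ^ l))
      = x * (\<Sum>i=2..Suc m. x ^ (Suc m - i) * (\<Sum>l\<le>i. x ^ (i - l) * y ^ l))
        + (\<Sum>l\<le>m+2. x ^ (m + 2 - l) * y ^ l)"
      using sum_digits_Suc[of 2 "Suc m" "\<lambda>_. 1" x "\<lambda>i. \<Sum>l\<le>i. x ^ (i - l) * y ^ l"]
      by (simp del: sum.atMost_Suc)
    then have "(x - y) ^ 2 * (\<Sum>i=2..Suc (Suc m). x ^ (Suc (Suc m) - i) * (\<Sum>l\<le>i. x ^ (i - l) * y ^ l))
      = x * ((x - y) ^ 2 * (\<Sum>i=2..Suc m. x ^ (Suc m - i) * (\<Sum>l\<le>i. x ^ (i - l) * y ^ l)))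
        + (x - y) * ((x - y) * (\<Sum>l\<le>m+2. x ^ (m + 2 - l) * y ^ l))"
      by (simp only: ring_distribs ac_simps power2_eq_square)
    then show ?case
      unfolding Suc geo by (simp add: algebra_simps power2_eq_square power3_eq_cube)
  qed simp
  from this[of "n - 1"] show ?thesis
    using assms by (simp add: of_nat_diff)
qed

theorem theorem1p1:
  fixes a b d n :: nat and S S1 S2 :: "nat set"
  assumes "a > 0" and "b > 0" and "d > 0" and "n > 0"
    and "d dvd b" and "gcd a b = 1"
    and S: "S = generated {a ^ n + j * a ^ (n - 1) * d |j. j \<le> b div d}"
    and S1: "S1 = generated (S \<union> {a ^ n + a ^ (n - i) * b ^ i |i. 2 \<le> i \<and> i \<le> n})"
    and S2: "S2 = generated (S \<union> {a ^ n + (\<Sum>i=1..j. a ^ (n - i) * b ^ i) |j. 2 \<le> j \<and> j \<le> n})"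
  shows "(b \<le> a \<longrightarrow>
           numerical_semigroup S1 \<and>
           real_of_int (frobenius_number S1) =
             real a ^ (n - 1) *
               (real a * of_int \<lceil>(real a - 1) * real d / real b\<rceil>
                 + real a * real d - real a - real d)
             + (real a - 1) *
               (((real n - 1) * real a ^ n * (real a - real b)
                  + real b ^ 2 * (real a ^ (n - 1) - real b ^ (n - 1)))
                / (real a - real b)))
       \<and> numerical_semigroup S2
       \<and> real_of_int (frobenius_number S2) =
           real a ^ (n - 1) *
             (real a * of_int \<lceil>(real a - 1) * real d / real b\<rceil>
               + real a * real d - real a - real d)
           + (real a - 1) *
             (((real n - 1) * real a ^ (n + 1) * (real a - real b)
                - real b ^ 3 * (real a ^ (n - 1) - real b ^ (n - 1)))
              / (real a - real b) ^ 2)"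
proof -
  define k where "k = b div d"
  have b: "b = k * d" and "k > 0"
    using \<open>d dvd b\<close> \<open>b > 0\<close> by (auto simp: k_def intro: Nat.gr0I)
  have "coprime a b"
    using \<open>gcd a b = 1\<close> by (simp add: coprime_iff_gcd_eq_1)
  text \<open>If \<open>a = b\<close>, then \<open>a = 1\<close>, and the factor \<open>real a - 1\<close> annihilates the junk value of the
    division by zero.\<close>
  have degenerate: "(real a - 1) * s = (real a - 1) * (t / u)"
    if "a \<noteq> b \<Longrightarrow> u * s = t" "a \<noteq> b \<Longrightarrow> u \<noteq> 0" for s t u :: real
  proof (cases "a = b")
    case True
    then show ?thesis
      using \<open>gcd a b = 1\<close> by simp
  next
    case False
    then show ?thesis
      using that by (simp add: field_simps)
  qed
  have S1_claim: "numerical_semigroup S1 \<and>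
           real_of_int (frobenius_number S1) =
             real a ^ (n - 1) *
               (real a * of_int \<lceil>(real a - 1) * real d / real b\<rceil>
                 + real a * real d - real a - real d)
             + (real a - 1) *
               (((real n - 1) * real a ^ n * (real a - real b)
                  + real b ^ 2 * (real a ^ (n - 1) - real b ^ (n - 1)))
                / (real a - real b))" if "b \<le> a"
  proof -
    \<comment> \<open>The subtraction is exact by \<open>b \<le> a\<close>. The interpretation is
      confined to this block, which frees \<open>g\<close> and \<open>semigroup\<close> for the
      second family.\<close>
    interpret generator_chain a b d k n "a - b" "\<lambda>i. a ^ i + b ^ i"
    proof
      show "a ^ Suc i + b ^ Suc i = b * (a ^ i + b ^ i) + (a - b) * a ^ i" for i
        using that by (simp add: diff_mult_distrib add_mult_distrib2 mult_le_mono1)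
    qed (use assms b \<open>k > 0\<close> \<open>coprime a b\<close> in auto)
    have g: "g i = a ^ n + a ^ (n - i) * b ^ i" if "i \<le> n" for i
      using that by (simp add: g_def algebra_simps flip: power_add)
    then have "{g i |i. 2 \<le> i \<and> i \<le> n} = {a ^ n + a ^ (n - i) * b ^ i |i. 2 \<le> i \<and> i \<le> n}"
      by force
    then have T: "semigroup = S1"
      unfolding semigroup_def S1 S by (simp add: k_def)
    have "(real a - 1) * (\<Sum>i=2..n. real (g i)) = (real a - 1) *
        (((real n - 1) * real a ^ n * (real a - real b)
          + real b ^ 2 * (real a ^ (n - 1) - real b ^ (n - 1))) / (real a - real b))"
      using sum_first_family[OF \<open>n > 0\<close>, of "real a" "real b"]
      by (intro degenerate) (simp_all add: g_def)
    then show ?thesis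
      using frobenius_real[OF T] by simp
  qed
  \<comment> \<open>The recursion splits off the term \<open>l = 0\<close> and takes a factor
    \<open>b\<close> out of the others.\<close>
  interpret generator_chain a b d k n a "\<lambda>i. \<Sum>l\<le>i. a ^ (i - l) * b ^ l"
  proof
    show "(\<Sum>l\<le>Suc i. a ^ (Suc i - l) * b ^ l) = b * (\<Sum>l\<le>i. a ^ (i - l) * b ^ l) + a * a ^ i" for i
      unfolding sum.atMost_Suc_shift by (simp add: sum_distrib_left ac_simps)
  qed (use assms b \<open>k > 0\<close> \<open>coprime a b\<close> in auto)
  have g: "g j = a ^ n + (\<Sum>i=1..j. a ^ (n - i) * b ^ i)" if "j \<le> n" for j
  proof -
    have "g j = (\<Sum>l\<le>j. a ^ (n - l) * b ^ l)"
      unfolding g_def sum_distrib_left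
      by (rule sum.cong) (use that in \<open>auto simp: mult.assoc[symmetric] simp flip: power_add\<close>)
    also have "{..j} = insert 0 {1..j}"
      by auto
    finally show ?thesis
      by simp
  qed
  then have "{g j |j. 2 \<le> j \<and> j \<le> n}
      = {a ^ n + (\<Sum>i=1..j. a ^ (n - i) * b ^ i) |j. 2 \<le> j \<and> j \<le> n}"
    by force
  then have T: "semigroup = S2"
    unfolding semigroup_def S2 S by (simp add: k_def)
  have "(real a - 1) * (\<Sum>i=2..n. real (g i)) = (real a - 1) *
      (((real n - 1) * real a ^ (n + 1) * (real a - real b)
        - real b ^ 3 * (real a ^ (n - 1) - real b ^ (n - 1))) / (real a - real b) ^ 2)"
    using sum_second_family[OF \<open>n > 0\<close>, of "real a" "real b"]
    by (intro degenerate) (simp_all add: g_def)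
  then show ?thesis
    using frobenius_real[OF T] S1_claim by simp
qed

end
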